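(* Let $Q$ be a quiver, let $\mathcal{P}$ be the set of all paths in $Q$ (including trivial paths), let $\top_{\mathcal{P}}:=\{(p,q)\in\mathcal{P}\times\mathcal{P}\mid t(p)=s(q)\}$, and let $\mu_{\mathcal{P}}:\top_{\mathcal{P}}\to\mathcal{P}$, $(p,q)\mapsto pq$, be composition of paths. Then $(\mathcal{P},\top_{\mathcal{P}},\mu_{\mathcal{P}})$ is a refined locality semigroup.
   Context: A quiver $Q=(Q_0,Q_1,s,t)$ consists of a set $Q_0$ of vertices, a set $Q_1$ of arrows and maps $s,t:Q_1\to Q_0$. A path in $Q$ is either a trivial path $e_v$ for a vertex $v\in Q_0$, with $s(e_v)=t(e_v)=v$, or a sequence $p=\alpha_1\cdots\alpha_k$ ($k\ge1$) of arrows with $t(\alpha_i)=s(\alpha_{i+1})$ for $1\le i\le k-1$, with $s(p)=s(\alpha_1)$ and $t(p)=t(\alpha_k)$. If $t(p)=s(q)$, the composition $pq$ is the concatenation of $p$ and $q$, where trivial paths act as identities: $e_{s(p)}p=p=pe_{t(p)}$. A locality set is a pair $(S,\top)$ with $S$ a set and $\top\subseteq S\times S$. A refined locality semigroup is a locality set $(S,\top)$ with a partial binary operation $\top\to S$, $(a,b)\mapsto ab$, such that for all $a,b,c\in S$: (i) if $(a,b)\in\top$, then $(b,c)\in\top$ if and only if $(ab,c)\in\top$; (ii) if $(b,c)\in\top$, then $(a,b)\in\top$ if and only if $(a,bc)\in\top$; (iii) if $(a,b),(b,c)\in\top$, then $(ab)c=a(bc)$. *)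

theory Defs
  imports "Graph_Theory.Digraph"
begin

text \<open>
  Quivers are the well-formed digraphs of the library, \<^term>\<open>wf_digraph Q\<close>: arbitrary sets
  of vertices and arrows, loops and parallel arrows allowed.  The source map is \<^term>\<open>tail Q\<close>
  and the target map is \<^term>\<open>head Q\<close>.
\<close>

datatype ('v, 'e) path = Trivial 'v | Arrows "'e list"

fun source :: "('v, 'e) pre_digraph \<Rightarrow> ('v, 'e) path \<Rightarrow> 'v" where
  "source Q (Trivial v) = v"
| "source Q (Arrows as) = tail Q (hd as)"

fun target :: "('v, 'e) pre_digraph \<Rightarrow> ('v, 'e) path \<Rightarrow> 'v" where
  "target Q (Trivial v) = v"
| "target Q (Arrows as) = head Q (last as)"

inductive_set paths :: "('v, 'e) pre_digraph \<Rightarrow> ('v, 'e) path set"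
  for Q :: "('v, 'e) pre_digraph" where
  trivial: "v \<in> verts Q \<Longrightarrow> Trivial v \<in> paths Q"
| arrows: "\<lbrakk>as \<noteq> []; set as \<subseteq> arcs Q;
    \<And>i. Suc i < length as \<Longrightarrow> head Q (as ! i) = tail Q (as ! Suc i)\<rbrakk>
    \<Longrightarrow> Arrows as \<in> paths Q"

definition composable :: "('v, 'e) pre_digraph \<Rightarrow> (('v, 'e) path \<times> ('v, 'e) path) set" where
  "composable Q = {(p, q) \<in> paths Q \<times> paths Q. target Q p = source Q q}"

text \<open>Meaningful only for pairs in \<^term>\<open>composable Q\<close>; other values are irrelevant.\<close>

fun compose :: "('v, 'e) path \<Rightarrow> ('v, 'e) path \<Rightarrow> ('v, 'e) path" where
  "compose (Trivial v) q = q"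
| "compose (Arrows as) (Trivial v) = Arrows as"
| "compose (Arrows as) (Arrows bs) = Arrows (as @ bs)"

locale locality_set =
  fixes S :: "'a set" and T :: "('a \<times> 'a) set"
  assumes locality_subset: "T \<subseteq> S \<times> S"

text \<open>
  The partial operation \<open>T \<rightarrow> S\<close> is represented by a total function whose values are constrained
  only on \<open>T\<close>.  In \<open>assoc\<close> both sides are defined: \<open>left_locality\<close> and \<open>right_locality\<close> put
  \<open>(m a b, c)\<close> and \<open>(a, m b c)\<close> in \<open>T\<close>.
\<close>

locale refined_locality_semigroup = locality_set S T
  for S :: "'a set" and T :: "('a \<times> 'a) set" +
  fixes m :: "'a \<Rightarrow> 'a \<Rightarrow> 'a"
  assumes closed: "(a, b) \<in> T \<Longrightarrow> m a b \<in> S"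
    and left_locality: "\<lbrakk>a \<in> S; b \<in> S; c \<in> S; (a, b) \<in> T\<rbrakk> \<Longrightarrow> (b, c) \<in> T \<longleftrightarrow> (m a b, c) \<in> T"
    and right_locality: "\<lbrakk>a \<in> S; b \<in> S; c \<in> S; (b, c) \<in> T\<rbrakk> \<Longrightarrow> (a, b) \<in> T \<longleftrightarrow> (a, m b c) \<in> T"
    and assoc: "\<lbrakk>a \<in> S; b \<in> S; c \<in> S; (a, b) \<in> T; (b, c) \<in> T\<rbrakk> \<Longrightarrow> m (m a b) c = m a (m b c)"

end

theory Submission
  imports Defs
begin

text \<open>
  Composing \<open>p\<close> and \<open>q\<close> keeps the source of \<open>p\<close> and the target of \<open>q\<close>. Composability of a pair
  only compares the target of its first path with the source of its second, so \<open>(b, c)\<close> and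
  \<open>(ab, c)\<close> impose the same condition, as do \<open>(a, b)\<close> and \<open>(a, bc)\<close>: this gives both locality
  axioms. Associativity is that of list concatenation. The remaining point is closure, where the
  matching condition \<open>t(p) = s(q)\<close> is exactly what is needed at the one new junction of the
  concatenated arrow sequence.
\<close>

lemma Arrows_in_paths_iff:
  "Arrows as \<in> paths Q \<longleftrightarrow> as \<noteq> [] \<and> set as \<subseteq> arcs Q \<and>
     (\<forall>i. Suc i < length as \<longrightarrow> head Q (as ! i) = tail Q (as ! Suc i))"
  by (auto intro: paths.arrows elim: paths.cases)

lemma consecutive_append:
  assumes as: "\<And>i. Suc i < length as \<Longrightarrow> R (as ! i) (as ! Suc i)"
    and bs: "\<And>i. Suc i < length bs \<Longrightarrow> R (bs ! i) (bs ! Suc i)"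
    and junction: "as \<noteq> [] \<Longrightarrow> bs \<noteq> [] \<Longrightarrow> R (last as) (hd bs)"
    and i: "Suc i < length (as @ bs)"
  shows "R ((as @ bs) ! i) ((as @ bs) ! Suc i)"
proof -
  consider "Suc i < length as" | "Suc i = length as" | "length as \<le> i" by linarith
  then show ?thesis
  proof cases
    case 1
    then show ?thesis using as by (simp add: nth_append)
  next
    case 2
    then have "as \<noteq> []" "bs \<noteq> []" "i = length as - 1" using i by auto
    then show ?thesis using 2 junction by (simp add: nth_append last_conv_nth hd_conv_nth)
  next
    case 3
    then show ?thesis using i bs[of "i - length as"] by (simp add: nth_append Suc_diff_le)
  qed
qed

lemma compose_in_paths:
  assumes p: "p \<in> paths Q" and q: "q \<in> paths Q" and pq: "target Q p = source Q q"
  shows "compose p q \<in> paths Q"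
proof (cases p; cases q)
  fix as bs
  assume eqs: "p = Arrows as" "q = Arrows bs"
  have "head Q ((as @ bs) ! i) = tail Q ((as @ bs) ! Suc i)" if "Suc i < length (as @ bs)" for i
    using p q pq that unfolding eqs
    by (intro consecutive_append[where R = "\<lambda>x y. head Q x = tail Q y"])
      (auto simp: Arrows_in_paths_iff)
  then show ?thesis
    using p q unfolding eqs by (auto simp: Arrows_in_paths_iff)
qed (use p q in auto)

text \<open>
  If one factor is trivial, the composability condition is what makes the end it contributes
  agree with that of the other factor. Membership in the set of paths excludes the empty arrow
  sequence, whose source and target are unspecified.
\<close>

lemma source_compose:
  assumes "p \<in> paths Q" "target Q p = source Q q"
  shows "source Q (compose p q) = source Q p"
  using assms by (cases p; cases q) (auto simp: Arrows_in_paths_iff)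

lemma target_compose:
  assumes "q \<in> paths Q" "target Q p = source Q q"
  shows "target Q (compose p q) = target Q q"
  using assms by (cases p; cases q) (auto simp: Arrows_in_paths_iff)

lemma compose_assoc: "compose (compose p q) r = compose p (compose q r)"
  by (cases p; cases q; cases r) auto

theorem proposition2p22:
  fixes Q :: "('v, 'e) pre_digraph"
  assumes "wf_digraph Q"
  shows "refined_locality_semigroup (paths Q) (composable Q) compose"
proof unfold_locales
  show "composable Q \<subseteq> paths Q \<times> paths Q"
    by (auto simp: composable_def)
qed (auto simp: composable_def compose_in_paths source_compose target_compose compose_assoc)

end
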